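(* For every $N\ge1$, the prefix tree for $\mathrm{Av}_N(321)$ is isomorphic to the prefix tree for $\mathrm{Av}_N(312)$: there is a bijection $\Phi$ from the set of prefixes for $\mathrm{Av}_N(321)$ to the set of prefixes for $\mathrm{Av}_N(312)$ which preserves the tree structure (i.e. $p$ is a prefix flattening of $q$ if and only if $\Phi(p)$ is a prefix flattening of $\Phi(q)$) and preserves strike probabilities, $S_N(\Phi(p))=S_N(p)$ as pairs of integers.
   Context: For a pattern $\rho$ (a permutation of $[M]$), $\mathrm{Av}_N(\rho)$ is the set of permutations $\pi=\pi_1\cdots\pi_N$ of $[N]$ with no subsequence $\pi_{i_1}\cdots\pi_{i_M}$ ($i_1<\dots<i_M$) in the same relative order as $\rho$. The $i$th prefix flattening $\pi|_{[i]}$ is the permutation of $[i]$ in the same relative order as $\pi_1,\dots,\pi_i$. For a set $I_N$ of permutations of $[N]$, a prefix is a permutation $p$ of $[k]$, $1\le k\le N$, with $p=\pi|_{[k]}$ for some $\pi\in I_N$; a prefix $q$ has $p$ (of size $k$) as a prefix flattening if $q|_{[k]}=p$; the prefix tree is the set of prefixes ordered by this relation. The strike probability of a prefix $p$ of size $k$ is the pair of integers $S_N(p)=\big(\#\{\pi\in I_N:\pi|_{[k]}=p,\ \pi_k=N\},\ \#\{\pi\in I_N:\pi|_{[k]}=p\}\big)$. *)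

theory Defs
  imports "HOL-Combinatorics.Multiset_Permutations" "HOL-Library.Sublist"
begin

text \<open>A permutation of [n] is written in one-line notation, i.e. as an element of
  \<^term>\<open>permutations_of_set {1..n::nat}\<close>; its size is the length of the list.\<close>

definition same_relative_order :: "nat list \<Rightarrow> nat list \<Rightarrow> bool" where
  "same_relative_order xs ys \<longleftrightarrow> length xs = length ys \<and>
     (\<forall>i<length xs. \<forall>j<length xs. xs ! i < xs ! j \<longleftrightarrow> ys ! i < ys ! j)"

definition Av :: "nat \<Rightarrow> nat list \<Rightarrow> nat list set" where
  "Av N \<rho> = {\<pi> \<in> permutations_of_set {1..N}. \<not> (\<exists>s. subseq s \<pi> \<and> same_relative_order s \<rho>)}"

text \<open>The description below determines a unique list when the entries of \<^term>\<open>\<pi>\<close> are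
  distinct and \<^term>\<open>i \<le> length \<pi>\<close>; see the lemmas that follow. For
  \<^term>\<open>i > length \<pi>\<close> the value is unspecified.\<close>

definition prefix_flattening :: "nat \<Rightarrow> nat list \<Rightarrow> nat list" where
  "prefix_flattening i \<pi> =
     (THE p. p \<in> permutations_of_set {1..i} \<and> same_relative_order p (take i \<pi>))"

lemma nth_eq_rank:
  assumes "p \<in> permutations_of_set {1..k}" "i < k"
  shows "p ! i = card {j. j < k \<and> p ! j \<le> p ! i}"
proof -
  have d: "distinct p" and s: "set p = {1..k}" and l: "length p = k"
    using assms(1) by (auto simp: permutations_of_set_def distinct_card[symmetric])
  have "(!) p ` {j. j < k \<and> p ! j \<le> p ! i} = {y \<in> set p. y \<le> p ! i}"
    using l by (auto simp: in_set_conv_nth)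
  also have "\<dots> = {1..p ! i}"
    using s l assms(2) nth_mem[of i p] by auto
  finally have "card ((!) p ` {j. j < k \<and> p ! j \<le> p ! i}) = p ! i" by simp
  moreover have "inj_on ((!) p) {j. j < k \<and> p ! j \<le> p ! i}"
    using d l by (auto simp: inj_on_def nth_eq_iff_index_eq)
  ultimately show ?thesis by (simp add: card_image)
qed

lemma ex1_same_relative_order:
  assumes "distinct xs"
  shows "\<exists>!p. p \<in> permutations_of_set {1..length xs} \<and> same_relative_order p xs"
proof (rule ex_ex1I)
  define r where "r x = card {y \<in> set xs. y \<le> x}" for x
  have mono: "r x < r y" if "x \<in> set xs" "y \<in> set xs" "x < y" for x y
  proof -
    have "y \<in> {z \<in> set xs. z \<le> y} - {z \<in> set xs. z \<le> x}" using that by auto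
    moreover have "{z \<in> set xs. z \<le> x} \<subseteq> {z \<in> set xs. z \<le> y}" using that by auto
    ultimately show ?thesis unfolding r_def by (intro psubset_card_mono) (simp, blast)
  qed
  have iff: "r x < r y \<longleftrightarrow> x < y" if "x \<in> set xs" "y \<in> set xs" for x y
    using mono[of x y] mono[of y x] that by (metis less_asym linorder_neqE_nat)
  have inj: "inj_on r (set xs)"
    by (rule inj_onI) (metis iff less_irrefl linorder_neqE_nat)
  have "r x \<in> {1..length xs}" if "x \<in> set xs" for x
  proof -
    have "{y \<in> set xs. y \<le> x} \<noteq> {}" using that by auto
    then have "r x \<ge> 1" unfolding r_def by (simp add: Suc_le_eq card_gt_0_iff)
    moreover have "r x \<le> card (set xs)" unfolding r_def by (rule card_mono) auto
    ultimately show ?thesis using assms by (simp add: distinct_card)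
  qed
  then have "r ` set xs = {1..length xs}"
    by (intro card_subset_eq) (auto simp: card_image[OF inj] distinct_card[OF assms])
  then have "map r xs \<in> permutations_of_set {1..length xs}"
    using assms inj by (simp add: permutations_of_set_def distinct_map)
  moreover have "same_relative_order (map r xs) xs"
    by (simp add: same_relative_order_def iff)
  ultimately show "\<exists>p. p \<in> permutations_of_set {1..length xs} \<and> same_relative_order p xs"
    by blast
next
  fix p q
  assume p: "p \<in> permutations_of_set {1..length xs} \<and> same_relative_order p xs"
    and q: "q \<in> permutations_of_set {1..length xs} \<and> same_relative_order q xs"
  have *: "l ! i = card {j. j < length xs \<and> xs ! j \<le> xs ! i}"
    if "l \<in> permutations_of_set {1..length xs} \<and> same_relative_order l xs" "i < length xs" for l i
  proof -
    have "{j. j < length xs \<and> l ! j \<le> l ! i} = {j. j < length xs \<and> xs ! j \<le> xs ! i}"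
      using that by (auto simp: same_relative_order_def simp flip: not_less)
    then show ?thesis using nth_eq_rank that by metis
  qed
  show "p = q"
    by (rule nth_equalityI) (use p q in \<open>auto simp: same_relative_order_def *[OF p] *[OF q]\<close>)
qed

lemma prefix_flattening_eq_iff:
  assumes "distinct \<pi>" "i \<le> length \<pi>"
  shows "prefix_flattening i \<pi> = p \<longleftrightarrow>
    p \<in> permutations_of_set {1..i} \<and> same_relative_order p (take i \<pi>)"
proof -
  have ex1: "\<exists>!p. p \<in> permutations_of_set {1..i} \<and> same_relative_order p (take i \<pi>)"
    using ex1_same_relative_order[of "take i \<pi>"] assms by (simp add: min_absorb2)
  from theI'[OF this] the1_equality[OF this] show ?thesis
    unfolding prefix_flattening_def by blast
qed

definition prefixes_of :: "nat \<Rightarrow> nat list set \<Rightarrow> nat list set" where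
  "prefixes_of N I = {p. \<exists>k \<pi>. 1 \<le> k \<and> k \<le> N \<and> \<pi> \<in> I \<and> p = prefix_flattening k \<pi>}"

definition is_prefix_flattening_of :: "nat list \<Rightarrow> nat list \<Rightarrow> bool" where
  "is_prefix_flattening_of p q \<longleftrightarrow>
     length p \<le> length q \<and> prefix_flattening (length p) q = p"

text \<open>Lists are indexed from 0, so the entry of \<^term>\<open>\<pi>\<close> in position \<^term>\<open>length p\<close> is
  \<^term>\<open>\<pi> ! (length p - 1)\<close>; prefixes are nonempty.\<close>

definition strike_probability :: "nat \<Rightarrow> nat list set \<Rightarrow> nat list \<Rightarrow> nat \<times> nat" where
  "strike_probability N I p =
     (card {\<pi> \<in> I. prefix_flattening (length p) \<pi> = p \<and> \<pi> ! (length p - 1) = N},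
      card {\<pi> \<in> I. prefix_flattening (length p) \<pi> = p})"

end

theory Submission
  imports Defs
begin

text \<open>Appending a last value \<open>v\<close> to a permutation \<open>p\<close> of \<open>[k]\<close> (raising the entries that are at
  least \<open>v\<close>) gives all permutations of \<open>[k + 1]\<close> whose prefix flattening is \<open>p\<close>. For both patterns,
  \<open>v = k + 1\<close> is always allowed. Let \<open>c\<close> be the number of allowed \<open>v \<le> k\<close>. The child with
  \<open>v = k + 1\<close> has \<open>c + 1\<close> such values, and the other children have \<open>1, \<dots>, c\<close> of them, each number
  once. Hence a prefix is determined by the sequence of the numbers \<open>c\<close> along the path to it, the
  same sequences occur for both patterns, and equal sequences give \<open>\<Phi>\<close>. The entry in position \<open>k\<close> of
  a permutation of \<open>[N]\<close> is \<open>N\<close> iff the sequence increases at step \<open>k\<close> but not later, so strike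
  probabilities can be read off the sequences, too.\<close>

section \<open>Appending a last value\<close>

text \<open>The increasing injection of the naturals whose image misses exactly \<open>v\<close>.
  Strict monotonicity keeps relative orders intact.\<close>

definition shift :: "nat \<Rightarrow> nat \<Rightarrow> nat" where
  "shift v a = (if v \<le> a then Suc a else a)"

definition append_value :: "nat list \<Rightarrow> nat \<Rightarrow> nat list" where
  "append_value p v = map (shift v) p @ [v]"

lemma shift_less_iff [simp]: "shift v a < shift v b \<longleftrightarrow> a < b"
  by (auto simp: shift_def)

lemma shift_eq_iff [simp]: "shift v a = shift v b \<longleftrightarrow> a = b"
  by (auto simp: shift_def)

lemma inj_shift: "inj_on (shift v) A"
  by (auto simp: inj_on_def)

lemma length_append_value [simp]: "length (append_value p v) = Suc (length p)"
  by (simp add: append_value_def)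

lemma length_of_permutation: "p \<in> permutations_of_set {1..k} \<Longrightarrow> length p = k"
  by (auto simp: permutations_of_set_def distinct_card[symmetric])

lemma shift_image:
  assumes "v \<in> {1..Suc k}"
  shows "shift v ` {1..k} = {1..Suc k} - {v}"
proof
  show "shift v ` {1..k} \<subseteq> {1..Suc k} - {v}"
    by (auto simp: shift_def)
  show "{1..Suc k} - {v} \<subseteq> shift v ` {1..k}"
  proof
    fix x assume "x \<in> {1..Suc k} - {v}"
    then have "x = shift v (if v < x then x - 1 else x)" "(if v < x then x - 1 else x) \<in> {1..k}"
      using assms by (auto simp: shift_def)
    then show "x \<in> shift v ` {1..k}" by blast
  qed
qed

lemma append_value_in_permutations:
  assumes "p \<in> permutations_of_set {1..k}" "v \<in> {1..Suc k}"
  shows "append_value p v \<in> permutations_of_set {1..Suc k}"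
  using assms shift_image[OF assms(2)]
  by (auto simp: permutations_of_set_def append_value_def distinct_map inj_shift)

lemma permutation_Suc_cases:
  assumes "q \<in> permutations_of_set {1..Suc k}"
  obtains p v where "p \<in> permutations_of_set {1..k}" "v \<in> {1..Suc k}" "q = append_value p v"
proof -
  have "q \<noteq> []" using assms by (auto simp: permutations_of_set_def)
  then obtain xs v where q: "q = xs @ [v]" by (metis rev_exhaust)
  have d: "distinct xs" and v: "v \<in> {1..Suc k}" and xs: "set xs = {1..Suc k} - {v}"
    using assms by (auto simp: q permutations_of_set_def)
  \<comment> \<open>The entries before \<open>v\<close> fill \<open>{1..Suc k} - {v}\<close>, the
    image of \<open>{1..k}\<close> under \<open>shift v\<close>, so the raising can be
    undone.\<close>
  define p where "p = map (the_inv_into {1..k} (shift v)) xs"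
  have *: "shift v (the_inv_into {1..k} (shift v) x) = x" if "x \<in> set xs" for x
    using that xs shift_image[OF v] by (intro f_the_inv_into_f inj_shift) auto
  have "map (shift v) p = xs"
    unfolding p_def by (simp add: * map_idI del: One_nat_def)
  then have "q = append_value p v" by (simp add: append_value_def q)
  moreover have "distinct p"
    using d \<open>map (shift v) p = xs\<close> by (metis distinct_map)
  moreover have "shift v ` set p = shift v ` {1..k}"
    using \<open>map (shift v) p = xs\<close> xs shift_image[OF v] by (metis set_map)
  then have "set p = {1..k}"
    using inj_image_eq_iff[OF inj_shift] by blast
  ultimately show ?thesis using that v by (simp add: permutations_of_set_def)
qed

section \<open>Prefix flattenings and their behaviour under appending\<close>

lemma same_relative_order_trans:
  "same_relative_order xs ys \<Longrightarrow> same_relative_order ys zs \<Longrightarrow> same_relative_order xs zs"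
  by (simp add: same_relative_order_def)

lemma same_relative_order_take:
  "same_relative_order xs ys \<Longrightarrow> same_relative_order (take i xs) (take i ys)"
  by (auto simp: same_relative_order_def)

lemma same_relative_order_map_shift: "same_relative_order xs (map (shift v) xs)"
  by (simp add: same_relative_order_def)

lemma prefix_flattening_props:
  assumes "p \<in> permutations_of_set {1..n}" "k \<le> n"
  shows "prefix_flattening k p \<in> permutations_of_set {1..k}"
    "same_relative_order (prefix_flattening k p) (take k p)"
  using assms prefix_flattening_eq_iff[of p k] length_of_permutation[OF assms(1)]
  by (auto simp: permutations_of_set_def)

lemma prefix_flattening_eqI:
  assumes "p \<in> permutations_of_set {1..n}" "k \<le> n" "q \<in> permutations_of_set {1..k}"
    "same_relative_order q (take k p)"
  shows "prefix_flattening k p = q"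
  using assms prefix_flattening_eq_iff[of p k] length_of_permutation[OF assms(1)]
  by (auto simp: permutations_of_set_def)

lemma prefix_flattening_self:
  assumes "p \<in> permutations_of_set {1..n}"
  shows "prefix_flattening n p = p"
  using assms length_of_permutation[OF assms]
  by (intro prefix_flattening_eqI[OF assms]) (auto simp: same_relative_order_def)

text \<open>Both sides have the relative order of the first \<open>i\<close> entries of
  \<open>p\<close>, and only one permutation of \<open>{1..i}\<close> has that order.\<close>

lemma prefix_flattening_prefix_flattening:
  assumes p: "p \<in> permutations_of_set {1..n}" and "i \<le> k" "k \<le> n"
  shows "prefix_flattening i (prefix_flattening k p) = prefix_flattening i p"
proof (rule prefix_flattening_eqI[OF prefix_flattening_props(1)[OF p \<open>k \<le> n\<close>] \<open>i \<le> k\<close>])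
  have "i \<le> n" using assms by simp
  show "prefix_flattening i p \<in> permutations_of_set {1..i}"
    by (rule prefix_flattening_props(1)[OF p \<open>i \<le> n\<close>])
  have "same_relative_order (take i (prefix_flattening k p)) (take i p)"
    using same_relative_order_take[OF prefix_flattening_props(2)[OF p \<open>k \<le> n\<close>], of i] \<open>i \<le> k\<close>
    by (simp add: min_absorb1)
  then have "same_relative_order (take i p) (take i (prefix_flattening k p))"
    by (auto simp: same_relative_order_def)
  then show "same_relative_order (prefix_flattening i p) (take i (prefix_flattening k p))"
    by (rule same_relative_order_trans[OF prefix_flattening_props(2)[OF p \<open>i \<le> n\<close>]])
qed

lemma prefix_flattening_append_value:
  assumes p: "p \<in> permutations_of_set {1..k}" and v: "v \<in> {1..Suc k}" and "i \<le> k"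
  shows "prefix_flattening i (append_value p v) = prefix_flattening i p"
proof (rule prefix_flattening_eqI[OF append_value_in_permutations[OF p v]])
  show "i \<le> Suc k" using \<open>i \<le> k\<close> by simp
  show "prefix_flattening i p \<in> permutations_of_set {1..i}"
    by (rule prefix_flattening_props(1)[OF p \<open>i \<le> k\<close>])
  have "take i (append_value p v) = take i (map (shift v) p)"
    using \<open>i \<le> k\<close> length_of_permutation[OF p] by (simp add: append_value_def)
  then show "same_relative_order (prefix_flattening i p) (take i (append_value p v))"
    using same_relative_order_trans[OF prefix_flattening_props(2)[OF p \<open>i \<le> k\<close>]]
      same_relative_order_take[OF same_relative_order_map_shift] by metis
qed

section \<open>Codes of permutations\<close>

text \<open>A standard Catalan family. The prepended 0 stands for the empty permutation, which has
  no sites, and forces the first entry to be 1.\<close>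

fun codes :: "nat \<Rightarrow> nat list set" where
  "codes 0 = {[]}"
| "codes (Suc n) = {cs @ [c] | cs c. cs \<in> codes n \<and> c \<in> {1..Suc (last (0 # cs))}}"

text \<open>Positions count from 0, and \<^term>\<open>(0 # cs) ! k\<close> is the entry before \<^term>\<open>cs ! k\<close>, with
  the value 0 before the first one.\<close>

definition last_increase :: "nat list \<Rightarrow> nat \<Rightarrow> bool" where
  "last_increase cs k \<longleftrightarrow> cs ! k = Suc ((0 # cs) ! k) \<and>
     (\<forall>j. k < j \<and> j < length cs \<longrightarrow> cs ! j \<noteq> Suc ((0 # cs) ! j))"

lemma nth_Cons_append:
  "j \<le> length cs \<Longrightarrow> (x # cs @ ds) ! j = (x # cs) ! j"
  by (cases j) (auto simp: nth_append)

lemma last_increase_snoc: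
  "last_increase (cs @ [c]) (length cs) \<longleftrightarrow> c = Suc (last (0 # cs))"
proof -
  \<comment> \<open>Prepending 0 moves indices by one, so index \<open>length cs\<close> hits the
    last entry of \<open>0 # cs\<close>.\<close>
  have "(0 # cs @ [c]) ! length cs = last (0 # cs)"
    by (cases cs rule: rev_cases) (auto simp: nth_append)
  then show ?thesis by (auto simp: last_increase_def)
qed

text \<open>An increase at the new last position supersedes every earlier one; any other entry there
  leaves the last increase where it was.\<close>

lemma last_increase_snoc_less:
  assumes "k < length cs"
  shows "last_increase (cs @ [c]) k \<longleftrightarrow> last_increase cs k \<and> c \<noteq> Suc (last (0 # cs))"
proof -
  have l: "(0 # cs @ [c]) ! length cs = last (0 # cs)"
    by (cases cs rule: rev_cases) (auto simp: nth_append)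
  have n: "(0 # cs @ [c]) ! j = (0 # cs) ! j" "(cs @ [c]) ! j = cs ! j" if "j < length cs" for j
    using that by (simp_all add: nth_Cons_append nth_append)
  show ?thesis
    unfolding last_increase_def using assms l n
    by (auto simp: less_Suc_eq)
qed

text \<open>The succession rule of the Catalan generating tree. The value \<open>Suc k\<close> is
  kept out of \<open>sites\<close> because appending it is the step that puts a new maximum at the
  end.\<close>

locale catalan_pattern =
  fixes \<rho> :: "nat list" and sites :: "nat list \<Rightarrow> nat set"
  assumes sites_subset: "sites p \<subseteq> {1..length p}"
  assumes Nil_in_Av: "[] \<in> Av 0 \<rho>"
  assumes append_value_in_Av_iff:
    "p \<in> permutations_of_set {1..k} \<Longrightarrow> v \<in> {1..Suc k} \<Longrightarrow>
     append_value p v \<in> Av (Suc k) \<rho> \<longleftrightarrow> p \<in> Av k \<rho> \<and> v \<in> insert (Suc k) (sites p)"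
  assumes card_sites_top:
    "p \<in> permutations_of_set {1..k} \<Longrightarrow>
     card (sites (append_value p (Suc k))) = Suc (card (sites p))"
  assumes card_sites_bij:
    "p \<in> permutations_of_set {1..k} \<Longrightarrow>
     bij_betw (\<lambda>v. card (sites (append_value p v))) (sites p) {1..card (sites p)}"
begin

text \<open>Records the path from the root to \<open>p\<close>. Sizes start at 1, so the code is as
  long as \<open>p\<close>, and its entry at index \<open>i\<close> belongs to the prefix flattening
  of size \<open>i + 1\<close>.\<close>

definition code :: "nat list \<Rightarrow> nat list" where
  "code p = map (\<lambda>i. card (sites (prefix_flattening i p))) [1..<Suc (length p)]"

lemma length_code [simp]: "length (code p) = length p"
  by (simp add: code_def del: upt_Suc)

lemma code_Nil [simp]: "code [] = []"
  by (simp add: code_def)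

lemma Av_permutation: "p \<in> Av k \<rho> \<Longrightarrow> p \<in> permutations_of_set {1..k}"
  by (simp add: Av_def)

lemma Av_Suc_cases:
  assumes "q \<in> Av (Suc k) \<rho>"
  obtains p v where "p \<in> Av k \<rho>" "v \<in> insert (Suc k) (sites p)" "q = append_value p v"
proof -
  obtain p v where "p \<in> permutations_of_set {1..k}" "v \<in> {1..Suc k}" "q = append_value p v"
    using permutation_Suc_cases[OF Av_permutation[OF assms]] .
  then show ?thesis using that append_value_in_Av_iff assms by metis
qed

lemma site_range:
  "p \<in> Av k \<rho> \<Longrightarrow> v \<in> insert (Suc k) (sites p) \<Longrightarrow> v \<in> {1..Suc k}"
  using sites_subset[of p] length_of_permutation[OF Av_permutation, of p k] by auto

lemma append_value_in_Av:
  "p \<in> Av k \<rho> \<Longrightarrow> v \<in> insert (Suc k) (sites p) \<Longrightarrow> append_value p v \<in> Av (Suc k) \<rho>"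
  using append_value_in_Av_iff[OF Av_permutation site_range] by blast

lemma code_prefix_flattening:
  assumes p: "p \<in> permutations_of_set {1..n}" and "k \<le> n"
  shows "code (prefix_flattening k p) = take k (code p)"
  unfolding code_def using assms prefix_flattening_prefix_flattening[OF p _ \<open>k \<le> n\<close>]
  by (auto simp: length_of_permutation[OF p] take_map
      length_of_permutation[OF prefix_flattening_props(1)[OF assms]] simp del: upt_Suc)

lemma code_append_value:
  assumes p: "p \<in> permutations_of_set {1..k}" and v: "v \<in> {1..Suc k}"
  shows "code (append_value p v) = code p @ [card (sites (append_value p v))]"
proof -
  have "map (\<lambda>i. card (sites (prefix_flattening i (append_value p v)))) [1..<Suc k] =
      map (\<lambda>i. card (sites (prefix_flattening i p))) [1..<Suc k]"
    using prefix_flattening_append_value[OF p v] by (auto simp del: upt_Suc)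
  then show ?thesis
    unfolding code_def length_append_value length_of_permutation[OF p]
    using prefix_flattening_self[OF append_value_in_permutations[OF p v]] by simp
qed

text \<open>For \<open>k = 0\<close> the prepended 0 is the right value, because
  \<open>sites []\<close> is contained in the empty set \<open>{1..0}\<close>.\<close>

lemma last_code:
  assumes p: "p \<in> permutations_of_set {1..k}"
  shows "last (0 # code p) = card (sites p)"
proof (cases k)
  case 0
  then show ?thesis using p sites_subset[of "[]"] by simp
next
  case (Suc n)
  then have "code p = map (\<lambda>i. card (sites (prefix_flattening i p))) [1..<Suc n]
      @ [card (sites p)]"
    unfolding code_def using length_of_permutation[OF p] prefix_flattening_self[OF p] by simp
  then show ?thesis by simp
qed

text \<open>The top value supplies the one count that \<open>card_sites_bij\<close> leaves out, so
  the counts of the children of \<open>p\<close> are distinct and fill the range allowed in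
  \<open>codes\<close>.\<close>

lemma card_sites_append_value:
  assumes "p \<in> permutations_of_set {1..k}"
  shows "bij_betw (\<lambda>v. card (sites (append_value p v)))
    (insert (Suc k) (sites p)) {1..Suc (card (sites p))}"
proof -
  have "Suc k \<notin> sites p"
    using sites_subset[of p] length_of_permutation[OF assms] by auto
  then show ?thesis
    using notIn_Un_bij_betw[OF _ _ card_sites_bij[OF assms], of "Suc k"]
    by (simp add: card_sites_top[OF assms] atLeastAtMostSuc_conv)
qed

text \<open>By injectivity only the top value reaches the largest count. This is how a code shows
  where a new maximum was appended.\<close>

lemma card_sites_append_value_eq_Suc_iff:
  assumes "p \<in> permutations_of_set {1..k}" "v \<in> insert (Suc k) (sites p)"
  shows "card (sites (append_value p v)) = Suc (card (sites p)) \<longleftrightarrow> v = Suc k"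
  using bij_betw_imp_inj_on[OF card_sites_append_value[OF assms(1)]] assms(2)
    card_sites_top[OF assms(1)]
  by (metis (no_types, lifting) inj_onD insertI1)

text \<open>Induction on the size: the code without its last entry determines the parent, and the
  last entry then singles out one child.\<close>

lemma inj_on_code: "inj_on code (Av k \<rho>)"
proof (induction k)
  case 0
  then show ?case by (auto simp: inj_on_def Av_def)
next
  case (Suc k)
  show ?case
  proof (rule inj_onI)
    fix q q' assume q: "q \<in> Av (Suc k) \<rho>" and q': "q' \<in> Av (Suc k) \<rho>" and eq: "code q = code q'"
    obtain p v where p: "p \<in> Av k \<rho>" and v: "v \<in> insert (Suc k) (sites p)"
      and qv: "q = append_value p v"
      using Av_Suc_cases[OF q] .
    obtain p' v' where p': "p' \<in> Av k \<rho>" and v': "v' \<in> insert (Suc k) (sites p')"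
      and qv': "q' = append_value p' v'"
      using Av_Suc_cases[OF q'] .
    have "code p = code p'"
      and *: "card (sites (append_value p v)) = card (sites (append_value p' v'))"
      using eq code_append_value[OF Av_permutation[OF p] site_range[OF p v]]
        code_append_value[OF Av_permutation[OF p'] site_range[OF p' v']] by (auto simp: qv qv')
    then have "p = p'" using Suc p p' by (auto dest: inj_onD)
    moreover have "v = v'"
      using inj_onD[OF bij_betw_imp_inj_on[OF card_sites_append_value[OF Av_permutation[OF p]]]]
        * v v' unfolding \<open>p = p'\<close> by blast
    ultimately show "q = q'" by (simp add: qv qv')
  qed
qed

text \<open>Since the child counts exhaust their range, every admissible next entry of a code is
  realised by some appended value.\<close>

lemma code_image: "code ` Av k \<rho> = codes k"
proof (induction k)
  case 0
  have "Av 0 \<rho> = {[]}" using Nil_in_Av by (auto simp: Av_def)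
  then show ?case by simp
next
  case (Suc k)
  show ?case
  proof (intro equalityI subsetI)
    fix cs assume "cs \<in> code ` Av (Suc k) \<rho>"
    then obtain q where q: "q \<in> Av (Suc k) \<rho>" and cs: "cs = code q" by blast
    obtain p v where p: "p \<in> Av k \<rho>" and v: "v \<in> insert (Suc k) (sites p)"
      and qv: "q = append_value p v"
      using Av_Suc_cases[OF q] .
    have "card (sites q) \<in> {1..Suc (card (sites p))}"
      using bij_betwE[OF card_sites_append_value[OF Av_permutation[OF p]]] v unfolding qv by blast
    moreover have "code p \<in> codes k" using Suc p by blast
    ultimately show "cs \<in> codes (Suc k)"
      using code_append_value[OF Av_permutation[OF p] site_range[OF p v]]
        last_code[OF Av_permutation[OF p]]
      by (auto simp: cs qv)
  next
    fix ds assume "ds \<in> codes (Suc k)"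
    then obtain cs c where ds: "ds = cs @ [c]" "cs \<in> codes k" "c \<in> {1..Suc (last (0 # cs))}"
      by auto
    then obtain p where p: "p \<in> Av k \<rho>" and cs: "cs = code p" using Suc by blast
    obtain v where v: "v \<in> insert (Suc k) (sites p)" and c: "c = card (sites (append_value p v))"
      using bij_betw_imp_surj_on[OF card_sites_append_value[OF Av_permutation[OF p]]] ds(3)
      unfolding cs last_code[OF Av_permutation[OF p]] by blast
    have "code (append_value p v) = ds"
      using code_append_value[OF Av_permutation[OF p] site_range[OF p v]] by (simp add: ds cs c)
    then show "ds \<in> code ` Av (Suc k) \<rho>"
      using append_value_in_Av[OF p v] by blast
  qed
qed

lemma prefix_flattening_in_Av:
  "\<pi> \<in> Av n \<rho> \<Longrightarrow> k \<le> n \<Longrightarrow> prefix_flattening k \<pi> \<in> Av k \<rho>"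
proof (induction n arbitrary: \<pi>)
  case 0
  then show ?case using prefix_flattening_self[OF Av_permutation] by simp
next
  case (Suc n)
  show ?case
  proof (cases "k = Suc n")
    case True
    then show ?thesis using prefix_flattening_self[OF Av_permutation] Suc.prems by simp
  next
    case False
    obtain p v where p: "p \<in> Av n \<rho>" and v: "v \<in> insert (Suc n) (sites p)"
      and qv: "\<pi> = append_value p v"
      using Av_Suc_cases[OF Suc.prems(1)] .
    show ?thesis
      using Suc.IH[OF p] False Suc.prems
        prefix_flattening_append_value[OF Av_permutation[OF p] site_range[OF p v]]
      by (simp add: qv)
  qed
qed

text \<open>Appending \<open>Suc n\<close> puts the maximum at the end and increases the code.
  Appending a smaller value raises the old maximum \<open>n\<close> to \<open>Suc n\<close> in its
  place, and the code does not increase.\<close>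

lemma nth_eq_max_iff:
  "\<pi> \<in> Av n \<rho> \<Longrightarrow> k < n \<Longrightarrow> \<pi> ! k = n \<longleftrightarrow> last_increase (code \<pi>) k"
proof (induction n arbitrary: \<pi>)
  case 0
  then show ?case by simp
next
  case (Suc n)
  obtain p v where p: "p \<in> Av n \<rho>" and v: "v \<in> insert (Suc n) (sites p)"
    and qv: "\<pi> = append_value p v"
    using Av_Suc_cases[OF Suc.prems(1)] .
  note p' = Av_permutation[OF p]
  have l: "length p = n" by (rule length_of_permutation[OF p'])
  have c: "code \<pi> = code p @ [card (sites (append_value p v))]"
    using code_append_value[OF p' site_range[OF p v]] by (simp add: qv)
  have top: "card (sites (append_value p v)) = Suc (last (0 # code p)) \<longleftrightarrow> v = Suc n"
    using card_sites_append_value_eq_Suc_iff[OF p' v] last_code[OF p'] by simp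
  show ?case
  proof (cases "k = n")
    case True
    then show ?thesis
      using last_increase_snoc[of "code p"] top l
      by (simp add: c) (simp add: qv append_value_def nth_append)
  next
    case False
    then have k: "k < n" using Suc.prems by simp
    then have "p ! k \<in> {1..n}"
      using p' l nth_mem[of k p] by (auto simp: permutations_of_set_def)
    then have "shift v (p ! k) = Suc n \<longleftrightarrow> p ! k = n \<and> v \<noteq> Suc n"
      using site_range[OF p v] by (auto simp: shift_def)
    moreover have "\<pi> ! k = shift v (p ! k)"
      using k l by (simp add: qv append_value_def nth_append)
    moreover have "last_increase (code \<pi>) k \<longleftrightarrow> last_increase (code p) k \<and> v \<noteq> Suc n"
      using last_increase_snoc_less[of k "code p"] k l top by (simp add: c)
    ultimately show ?thesis using Suc.IH[OF p k] by simp
  qed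
qed

section \<open>Prefixes, their order and strike probabilities in terms of codes\<close>

lemma prefixes_of_cases:
  assumes "p \<in> prefixes_of N (Av N \<rho>)"
  shows "p \<in> Av (length p) \<rho>" "1 \<le> length p" "length p \<le> N"
proof -
  obtain k \<pi> where k: "1 \<le> k" "k \<le> N" "\<pi> \<in> Av N \<rho>" "p = prefix_flattening k \<pi>"
    using assms by (auto simp: prefixes_of_def)
  then have "p \<in> Av k \<rho>" using prefix_flattening_in_Av by blast
  moreover then have "length p = k" by (rule length_of_permutation[OF Av_permutation])
  ultimately show "p \<in> Av (length p) \<rho>" "1 \<le> length p" "length p \<le> N" using k by auto
qed

lemma code_eq_iff:
  assumes "p \<in> Av k \<rho>" "q \<in> Av m \<rho>"
  shows "code p = code q \<longleftrightarrow> p = q"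
proof
  assume eq: "code p = code q"
  have "length p = length q" using arg_cong[OF eq, of length] by simp
  then have "k = m" using assms length_of_permutation[OF Av_permutation] by metis
  then show "p = q" using inj_onD[OF inj_on_code eq] assms by simp
qed simp

text \<open>The target set does not mention the pattern, which makes the trees of two patterns
  comparable.\<close>

lemma bij_betw_code:
  "bij_betw code (prefixes_of N (Av N \<rho>)) {take k cs | k cs. 1 \<le> k \<and> k \<le> N \<and> cs \<in> codes N}"
proof (rule bij_betw_imageI)
  show "inj_on code (prefixes_of N (Av N \<rho>))"
    using code_eq_iff prefixes_of_cases(1) by (intro inj_onI) metis
  have "code ` prefixes_of N (Av N \<rho>) =
      {code (prefix_flattening k \<pi>) | k \<pi>. 1 \<le> k \<and> k \<le> N \<and> \<pi> \<in> Av N \<rho>}"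
    by (auto simp: prefixes_of_def)
  also have "\<dots> = {take k (code \<pi>) | k \<pi>. 1 \<le> k \<and> k \<le> N \<and> \<pi> \<in> Av N \<rho>}"
    by (intro Collect_cong ex_cong1) (auto simp: code_prefix_flattening[OF Av_permutation])
  also have "\<dots> = {take k cs | k cs. 1 \<le> k \<and> k \<le> N \<and> cs \<in> codes N}"
    unfolding code_image[symmetric] by blast
  finally show "code ` prefixes_of N (Av N \<rho>) = \<dots>" .
qed

lemma prefix_flattening_eq_iff_code:
  assumes "p \<in> Av k \<rho>" "q \<in> Av m \<rho>" "k \<le> m"
  shows "prefix_flattening k q = p \<longleftrightarrow> take k (code q) = code p"
  using code_eq_iff[OF prefix_flattening_in_Av[OF assms(2,3)] assms(1)]
    code_prefix_flattening[OF Av_permutation[OF assms(2)] assms(3)] by simp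

lemma is_prefix_flattening_of_iff_code:
  assumes "p \<in> Av k \<rho>" "q \<in> Av m \<rho>"
  shows "is_prefix_flattening_of p q \<longleftrightarrow> prefix (code p) (code q)"
proof -
  have "length p = k" "length q = m"
    using assms length_of_permutation[OF Av_permutation] by auto
  moreover have "prefix xs ys \<longleftrightarrow> length xs \<le> length ys \<and> take (length xs) ys = xs"
    for xs ys :: "nat list"
    by (metis append_eq_conv_conj prefix_def prefix_length_le)
  ultimately show ?thesis
    using prefix_flattening_eq_iff_code[OF assms] by (auto simp: is_prefix_flattening_of_def)
qed

lemma strike_probability_code:
  assumes "p \<in> prefixes_of N (Av N \<rho>)"
  shows "strike_probability N (Av N \<rho>) p =
    (card {cs \<in> codes N. take (length p) cs = code p \<and> last_increase cs (length p - 1)},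
     card {cs \<in> codes N. take (length p) cs = code p})"
proof -
  note p = prefixes_of_cases[OF assms]
  \<comment> \<open>\<open>code\<close> is a bijection from \<open>Av N \<rho>\<close> to
    \<open>codes N\<close>, so a condition on codes can be counted on either side.\<close>
  have card_eq: "card {\<pi> \<in> Av N \<rho>. P (code \<pi>)} = card {cs \<in> codes N. P cs}" for P
  proof (rule bij_betw_same_card[of code], rule bij_betw_imageI)
    show "inj_on code {\<pi> \<in> Av N \<rho>. P (code \<pi>)}"
      by (rule inj_on_subset[OF inj_on_code]) auto
    show "code ` {\<pi> \<in> Av N \<rho>. P (code \<pi>)} = {cs \<in> codes N. P cs}"
      by (auto simp flip: code_image)
  qed
  have strike_eq: "{\<pi> \<in> Av N \<rho>. prefix_flattening (length p) \<pi> = p \<and> \<pi> ! (length p - 1) = N} =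
      {\<pi> \<in> Av N \<rho>. take (length p) (code \<pi>) = code p \<and> last_increase (code \<pi>) (length p - 1)}"
  proof (intro Collect_cong conj_cong refl)
    fix \<pi> assume \<pi>: "\<pi> \<in> Av N \<rho>"
    show "prefix_flattening (length p) \<pi> = p \<longleftrightarrow> take (length p) (code \<pi>) = code p"
      by (rule prefix_flattening_eq_iff_code[OF p(1) \<pi> p(3)])
    show "\<pi> ! (length p - 1) = N \<longleftrightarrow> last_increase (code \<pi>) (length p - 1)"
      using p(2,3) by (intro nth_eq_max_iff[OF \<pi>]) simp
  qed
  have prefix_eq: "{\<pi> \<in> Av N \<rho>. prefix_flattening (length p) \<pi> = p} =
      {\<pi> \<in> Av N \<rho>. take (length p) (code \<pi>) = code p}"
    by (intro Collect_cong conj_cong refl prefix_flattening_eq_iff_code[OF p(1) _ p(3)])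
  show ?thesis
    unfolding strike_probability_def strike_eq prefix_eq
      card_eq[of "\<lambda>cs. take (length p) cs = code p \<and> last_increase cs (length p - 1)"]
      card_eq[of "\<lambda>cs. take (length p) cs = code p"] ..
qed

end

theorem prefix_trees_isomorphic:
  assumes "catalan_pattern \<rho> S" "catalan_pattern \<sigma> T"
  shows "\<exists>\<Phi>.
    bij_betw \<Phi> (prefixes_of N (Av N \<rho>)) (prefixes_of N (Av N \<sigma>)) \<and>
    (\<forall>p \<in> prefixes_of N (Av N \<rho>). \<forall>q \<in> prefixes_of N (Av N \<rho>).
       is_prefix_flattening_of p q \<longleftrightarrow> is_prefix_flattening_of (\<Phi> p) (\<Phi> q)) \<and>
    (\<forall>p \<in> prefixes_of N (Av N \<rho>).
       strike_probability N (Av N \<sigma>) (\<Phi> p) = strike_probability N (Av N \<rho>) p)"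
proof -
  interpret A: catalan_pattern \<rho> S by fact
  interpret B: catalan_pattern \<sigma> T by fact
  define P where "P = prefixes_of N (Av N \<rho>)"
  define Q where "Q = prefixes_of N (Av N \<sigma>)"
  \<comment> \<open>\<open>\<Phi> p\<close> is the prefix for the second pattern that has the code
    of \<open>p\<close>.\<close>
  define \<Phi> where "\<Phi> = the_inv_into Q B.code \<circ> A.code"
  have bij: "bij_betw \<Phi> P Q"
    unfolding \<Phi>_def P_def Q_def
    by (rule bij_betw_trans[OF A.bij_betw_code bij_betw_the_inv_into[OF B.bij_betw_code]])
  have code: "B.code (\<Phi> p) = A.code p" if "p \<in> P" for p
    using that f_the_inv_into_f_bij_betw[OF B.bij_betw_code] bij_betwE[OF A.bij_betw_code]
    unfolding \<Phi>_def P_def Q_def by auto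
  have len: "length (\<Phi> p) = length p" if "p \<in> P" for p
    using arg_cong[OF code[OF that], of length] by simp
  have mem: "\<Phi> p \<in> Q" if "p \<in> P" for p
    using that bij by (rule bij_betwE[THEN bspec, rotated])
  have "is_prefix_flattening_of p q \<longleftrightarrow> is_prefix_flattening_of (\<Phi> p) (\<Phi> q)"
    if p: "p \<in> P" and q: "q \<in> P" for p q
  proof -
    note A = p[unfolded P_def, THEN A.prefixes_of_cases(1)]
      q[unfolded P_def, THEN A.prefixes_of_cases(1)]
    note B = mem[OF p, unfolded Q_def, THEN B.prefixes_of_cases(1)]
      mem[OF q, unfolded Q_def, THEN B.prefixes_of_cases(1)]
    show ?thesis
      unfolding A.is_prefix_flattening_of_iff_code[OF A]
        B.is_prefix_flattening_of_iff_code[OF B] code[OF p] code[OF q] ..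
  qed
  moreover have "strike_probability N (Av N \<sigma>) (\<Phi> p) = strike_probability N (Av N \<rho>) p"
    if p: "p \<in> P" for p
    unfolding A.strike_probability_code[OF p[unfolded P_def]]
      B.strike_probability_code[OF mem[OF p, unfolded Q_def]] code[OF p] len[OF p] ..
  ultimately show ?thesis using bij unfolding P_def Q_def by blast
qed

section \<open>The two patterns\<close>

text \<open>Ranks increase strictly along \<open>A\<close>, so they are \<open>card A\<close>
  distinct numbers in \<open>{1..card A}\<close>. Working inside the class lets the dual order give
  the rank from above.\<close>

lemma (in linorder) bij_betw_rank:
  assumes "finite A"
  shows "bij_betw (\<lambda>v. card {u \<in> A. u \<le> v}) A {1..card A}"
proof -
  have less: "card {u \<in> A. u \<le> v} < card {u \<in> A. u \<le> w}" if "w \<in> A" "v < w" for v w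
  proof (rule psubset_card_mono)
    have "w \<in> {u \<in> A. u \<le> w}" "w \<notin> {u \<in> A. u \<le> v}"
      using that by (simp_all add: not_le)
    moreover have "{u \<in> A. u \<le> v} \<subseteq> {u \<in> A. u \<le> w}"
      using order_trans[OF _ less_imp_le[OF that(2)]] by blast
    ultimately show "{u \<in> A. u \<le> v} \<subset> {u \<in> A. u \<le> w}" by blast
  qed (use assms in simp)
  have inj: "inj_on (\<lambda>v. card {u \<in> A. u \<le> v}) A"
  proof (rule inj_onI)
    fix v w assume "v \<in> A" "w \<in> A" "card {u \<in> A. u \<le> v} = card {u \<in> A. u \<le> w}"
    then show "v = w" using less[of w v] less[of v w] by (cases v w rule: linorder_cases) simp_all
  qed
  have "card {u \<in> A. u \<le> v} \<in> {1..card A}" if "v \<in> A" for v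
  proof -
    have "{u \<in> A. u \<le> v} \<noteq> {}" using that by blast
    then have "0 < card {u \<in> A. u \<le> v}" using assms by (simp add: card_gt_0_iff)
    moreover have "card {u \<in> A. u \<le> v} \<le> card A" by (rule card_mono[OF assms]) blast
    ultimately show ?thesis by simp
  qed
  then have "(\<lambda>v. card {u \<in> A. u \<le> v}) ` A \<subseteq> {1..card A}" by blast
  then have "(\<lambda>v. card {u \<in> A. u \<le> v}) ` A = {1..card A}"
    using card_image[OF inj] by (intro card_subset_eq) simp_all
  with inj show ?thesis by (rule bij_betw_imageI)
qed

lemma bij_betw_dual_rank:
  fixes A :: "'a :: linorder set"
  shows "finite A \<Longrightarrow> bij_betw (\<lambda>v. card {u \<in> A. v \<le> u}) A {1..card A}"
  using linorder.bij_betw_rank[OF dual_linorder, of A] by simp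

section \<open>Subsequences of an appended permutation\<close>

lemma subseq_map_iff: "subseq s (map f xs) \<longleftrightarrow> (\<exists>t. subseq t xs \<and> s = map f t)"
  unfolding subseq_conv_nths nths_map by blast

lemma subseq_singleton_right: "subseq t [x] \<longleftrightarrow> t = [] \<or> t = [x]"
  by (cases t) auto

lemma subseq_snoc_iff:
  "subseq s (xs @ [x]) \<longleftrightarrow> subseq s xs \<or> (\<exists>t. s = t @ [x] \<and> subseq t xs)"
  unfolding subseq_append_iff subseq_singleton_right by auto

lemma subseq_append_value_iff:
  "subseq s (append_value p v) \<longleftrightarrow>
    (\<exists>t. subseq t p \<and> (s = map (shift v) t \<or> s = map (shift v) t @ [v]))"
  unfolding append_value_def subseq_snoc_iff subseq_map_iff by blast

lemma map_eq_1: "[a] = map f t \<longleftrightarrow> (\<exists>a'. t = [a'] \<and> a = f a')"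
  by (cases t) auto

lemma map_eq_2: "[a, b] = map f t \<longleftrightarrow> (\<exists>a' b'. t = [a', b'] \<and> a = f a' \<and> b = f b')"
  by (cases t) (auto simp: map_eq_1)

lemma map_eq_3:
  "[a, b, c] = map f t \<longleftrightarrow> (\<exists>a' b' c'. t = [a', b', c'] \<and> a = f a' \<and> b = f b' \<and> c = f c')"
  by (cases t) (auto simp: map_eq_2)

lemma subseq_append_value3:
  "subseq [a, b, c] (append_value p v) \<longleftrightarrow>
    (\<exists>a' b' c'. subseq [a', b', c'] p \<and> a = shift v a' \<and> b = shift v b' \<and> c = shift v c') \<or>
    (\<exists>a' b'. subseq [a', b'] p \<and> a = shift v a' \<and> b = shift v b' \<and> c = v)"
proof -
  have "[a, b, c] = xs @ [v] \<longleftrightarrow> [a, b] = xs \<and> c = v" for xs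
    using append1_eq_conv[of "[a, b]" c xs v] by simp
  then show ?thesis
    unfolding subseq_append_value_iff conj_disj_distribL ex_disj_distrib map_eq_3
    by (intro arg_cong2[of _ _ _ _ "(\<or>)"]) (metis, simp add: map_eq_2, metis)
qed

lemma subseq_append_value2:
  "subseq [a, b] (append_value p v) \<longleftrightarrow>
    (\<exists>a' b'. subseq [a', b'] p \<and> a = shift v a' \<and> b = shift v b') \<or>
    (\<exists>a' \<in> set p. a = shift v a' \<and> b = v)"
proof -
  have "[a, b] = xs @ [v] \<longleftrightarrow> [a] = xs \<and> b = v" for xs
    using append1_eq_conv[of "[a]" b xs v] by simp
  then show ?thesis
    unfolding subseq_append_value_iff conj_disj_distribL ex_disj_distrib map_eq_2
    by (intro arg_cong2[of _ _ _ _ "(\<or>)"]) (metis, simp add: map_eq_1, metis subseq_singleton_left)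
qed

text \<open>A triple either lies within the old entries or ends in the new one. Avoidance by
  \<open>append_value p v\<close> thus splits into avoidance by \<open>p\<close> and a condition on
  pairs from \<open>p\<close>.\<close>

lemma all_subseq_append_value3:
  "(\<forall>a b c. subseq [a, b, c] (append_value p v) \<longrightarrow> P a b c) \<longleftrightarrow>
    (\<forall>a b c. subseq [a, b, c] p \<longrightarrow> P (shift v a) (shift v b) (shift v c)) \<and>
    (\<forall>a b. subseq [a, b] p \<longrightarrow> P (shift v a) (shift v b) v)"
  unfolding subseq_append_value3 by auto

lemma all_subseq_append_value2:
  "(\<forall>a b. subseq [a, b] (append_value p v) \<longrightarrow> P a b) \<longleftrightarrow>
    (\<forall>a b. subseq [a, b] p \<longrightarrow> P (shift v a) (shift v b)) \<and> (\<forall>a\<in>set p. P (shift v a) v)"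
  unfolding subseq_append_value2 by metis

section \<open>The two patterns as inequalities, and their sites\<close>

lemma same_relative_order_triple:
  "same_relative_order s [x, y, z] \<longleftrightarrow> (\<exists>a b c. s = [a, b, c] \<and>
     (a < b \<longleftrightarrow> x < y) \<and> (a < c \<longleftrightarrow> x < z) \<and> (b < a \<longleftrightarrow> y < x) \<and>
     (b < c \<longleftrightarrow> y < z) \<and> (c < a \<longleftrightarrow> z < x) \<and> (c < b \<longleftrightarrow> z < y))"
proof (cases "length s = 3")
  case True
  then obtain a b c where s: "s = [a, b, c]"
    by (auto simp: numeral_3_eq_3 length_Suc_conv)
  show ?thesis
    unfolding s same_relative_order_def by (simp add: All_less_Suc) blast
qed (auto simp: same_relative_order_def)

lemma same_relative_order_321:
  "same_relative_order s [3, 2, 1] \<longleftrightarrow> (\<exists>a b c. s = [a, b, c] \<and> c < b \<and> b < a)"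
  unfolding same_relative_order_triple by (intro ex_cong1) auto

lemma same_relative_order_312:
  "same_relative_order s [3, 1, 2] \<longleftrightarrow> (\<exists>a b c. s = [a, b, c] \<and> b < c \<and> c < a)"
  unfolding same_relative_order_triple by (intro ex_cong1) auto

lemma Av_321:
  "p \<in> Av k [3, 2, 1] \<longleftrightarrow> p \<in> permutations_of_set {1..k} \<and>
     (\<forall>a b c. subseq [a, b, c] p \<longrightarrow> \<not> (c < b \<and> b < a))"
  unfolding Av_def same_relative_order_321 by blast

lemma Av_312:
  "p \<in> Av k [3, 1, 2] \<longleftrightarrow> p \<in> permutations_of_set {1..k} \<and>
     (\<forall>a b c. subseq [a, b, c] p \<longrightarrow> \<not> (b < c \<and> c < a))"
  unfolding Av_def same_relative_order_312 by blast

text \<open>A last entry \<open>v\<close> completes a 321 with an inversion \<open>a, b\<close> of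
  \<open>p\<close> iff \<open>v < shift v b\<close>, that is \<open>v \<le> b\<close>; hence the
  weak inequality.\<close>

definition sites_321 :: "nat list \<Rightarrow> nat set" where
  "sites_321 p = {v \<in> {1..length p}. \<forall>a b. subseq [a, b] p \<longrightarrow> \<not> (v \<le> b \<and> b < a)}"

text \<open>A last entry \<open>v\<close> completes a 312 with \<open>a, b\<close> iff it lies
  strictly between the raised entries. Before raising this reads \<open>b < v\<close> and
  \<open>v \<le> a\<close>.\<close>

definition sites_312 :: "nat list \<Rightarrow> nat set" where
  "sites_312 p = {v \<in> {1..length p}. \<forall>a b. subseq [a, b] p \<longrightarrow> \<not> (b < v \<and> v \<le> a)}"

lemma subseq_permutation_range:
  assumes "p \<in> permutations_of_set {1..k}" "subseq [a, b] p"
  shows "a \<in> {1..k}" "b \<in> {1..k}"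
proof -
  have "set [a, b] \<subseteq> set p"
    using assms(2) by (metis subseq_conv_nths set_nths_subset)
  then show "a \<in> {1..k}" "b \<in> {1..k}"
    using assms(1) by (auto simp: permutations_of_set_def)
qed

text \<open>The new entry \<open>v\<close> is the smaller part of an inversion iff some old entry is
  at least \<open>v\<close>, that is iff \<open>v \<le> k\<close>. Such an inversion excludes all
  \<open>u \<le> v\<close>.\<close>

lemma mem_sites_321_append_value:
  assumes p: "p \<in> permutations_of_set {1..k}" and v: "v \<in> {1..Suc k}"
  shows "u \<in> sites_321 (append_value p v) \<longleftrightarrow> u \<in> {1..Suc k} \<and> (v \<le> k \<longrightarrow> v < u) \<and>
    (\<forall>a b. subseq [a, b] p \<longrightarrow> \<not> (u \<le> shift v b \<and> b < a))"
proof -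
  have "set p = {1..k}" using p by (simp add: permutations_of_set_def)
  moreover have "(\<forall>a\<in>{1..k}. \<not> (u \<le> v \<and> v < shift v a)) \<longleftrightarrow> (v \<le> k \<longrightarrow> v < u)"
    using v by (auto simp: shift_def not_le)
  ultimately show ?thesis
    using length_of_permutation[OF p]
    by (simp add: sites_321_def all_subseq_append_value2 del: One_nat_def) blast
qed

text \<open>If \<open>v \<le> k\<close>, the entry \<open>k\<close> is raised to
  \<open>Suc k\<close> and forms an inversion with \<open>v\<close>, which excludes every
  \<open>u\<close> above \<open>v\<close>. If \<open>v = Suc k\<close>, there is no such
  \<open>u\<close> in range.\<close>

lemma mem_sites_312_append_value:
  assumes p: "p \<in> permutations_of_set {1..k}" and v: "v \<in> {1..Suc k}"
  shows "u \<in> sites_312 (append_value p v) \<longleftrightarrow> u \<in> {1..v} \<and>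
    (\<forall>a b. subseq [a, b] p \<longrightarrow> \<not> (shift v b < u \<and> u \<le> shift v a))"
proof -
  have "set p = {1..k}" using p by (simp add: permutations_of_set_def)
  moreover have "\<exists>a\<in>{1..k}. u \<le> shift v a" if "v < u" "u \<le> Suc k"
    using that v by (intro bexI[of _ k]) (auto simp: shift_def)
  then have "u \<in> {1..Suc k} \<and> (\<forall>a\<in>{1..k}. \<not> (v < u \<and> u \<le> shift v a)) \<longleftrightarrow> u \<in> {1..v}"
    using v by fastforce
  ultimately show ?thesis
    using length_of_permutation[OF p]
    by (simp add: sites_312_def all_subseq_append_value2 del: One_nat_def) blast
qed

text \<open>The new entry exceeds all others, so no entry is raised and no inversion arises.
  \<open>Suc k\<close> becomes a site, as the smaller part of every inversion is at most
  \<open>k\<close>.\<close>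

lemma sites_321_append_top:
  assumes p: "p \<in> permutations_of_set {1..k}"
  shows "sites_321 (append_value p (Suc k)) = insert (Suc k) (sites_321 p)"
proof (rule set_eqI)
  fix u
  have b: "b \<le> k" if "subseq [a, b] p" for a b
    using subseq_permutation_range(2)[OF p that] by simp
  then have "(\<forall>a b. subseq [a, b] p \<longrightarrow> \<not> (u \<le> shift (Suc k) b \<and> b < a)) \<longleftrightarrow>
      (\<forall>a b. subseq [a, b] p \<longrightarrow> \<not> (u \<le> b \<and> b < a))"
    by (metis not_less_eq_eq shift_def)
  then have "u \<in> sites_321 (append_value p (Suc k)) \<longleftrightarrow>
      u \<in> {1..Suc k} \<and> (\<forall>a b. subseq [a, b] p \<longrightarrow> \<not> (u \<le> b \<and> b < a))"
    by (simp add: mem_sites_321_append_value[OF p])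
  also have "\<dots> \<longleftrightarrow> u \<in> insert (Suc k) (sites_321 p)"
    using b length_of_permutation[OF p] unfolding sites_321_def
    by (cases "u = Suc k") (simp, metis not_less_eq_eq, simp add: le_Suc_eq)
  finally show "u \<in> sites_321 (append_value p (Suc k)) \<longleftrightarrow> u \<in> insert (Suc k) (sites_321 p)" .
qed

text \<open>Sites for 321 are closed upwards within \<open>{1..k}\<close>, so those from
  \<open>v\<close> on form \<open>{v..k}\<close>. After appending \<open>v\<close>, exactly the
  values above \<open>v\<close> remain.\<close>

lemma sites_321_append_value:
  assumes p: "p \<in> permutations_of_set {1..k}" and v: "v \<in> sites_321 p"
  shows "sites_321 (append_value p v) = Suc ` {u \<in> sites_321 p. v \<le> u}"
proof -
  have l: "length p = k" by (rule length_of_permutation[OF p])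
  have vk: "v \<in> {1..k}" using v l by (simp add: sites_321_def)
  have less: "\<not> (v \<le> b \<and> b < a)" if "subseq [a, b] p" for a b
    using v that by (simp add: sites_321_def)
  have "u \<in> sites_321 (append_value p v) \<longleftrightarrow> u \<in> Suc ` {v..k}" for u
  proof -
    \<comment> \<open>As \<open>v\<close> is a site, an inversion with smaller part \<open>b\<close>
      has \<open>b < v\<close>, so \<open>b\<close> is not raised and stays below
      \<open>u\<close>.\<close>
    have "\<not> (u \<le> shift v b \<and> b < a)" if "subseq [a, b] p" "v < u" for a b
      using less[OF that(1)] that(2) by (auto simp: shift_def)
    then have "u \<in> sites_321 (append_value p v) \<longleftrightarrow> u \<in> {1..Suc k} \<and> v < u"
      using mem_sites_321_append_value[OF p, of v u] vk by auto
    also have "\<dots> \<longleftrightarrow> u \<in> Suc ` {v..k}" by auto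
    finally show ?thesis .
  qed
  moreover have "u \<in> sites_321 p \<and> v \<le> u \<longleftrightarrow> u \<in> {v..k}" for u
  proof -
    have "\<not> (u \<le> b \<and> b < a)" if "subseq [a, b] p" "v \<le> u" for a b
      using less[OF that(1)] that(2) by auto
    then show ?thesis unfolding sites_321_def using l vk by auto
  qed
  ultimately show ?thesis by blast
qed

text \<open>Again nothing is raised and no inversion arises. \<open>Suc k\<close> becomes a site,
  since the larger part of every inversion is at most \<open>k\<close>.\<close>

lemma sites_312_append_top:
  assumes p: "p \<in> permutations_of_set {1..k}"
  shows "sites_312 (append_value p (Suc k)) = insert (Suc k) (sites_312 p)"
proof (rule set_eqI)
  fix u
  have ab: "a \<le> k \<and> b \<le> k" if "subseq [a, b] p" for a b
    using subseq_permutation_range[OF p that] by simp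
  then have "(\<forall>a b. subseq [a, b] p \<longrightarrow> \<not> (shift (Suc k) b < u \<and> u \<le> shift (Suc k) a)) \<longleftrightarrow>
      (\<forall>a b. subseq [a, b] p \<longrightarrow> \<not> (b < u \<and> u \<le> a))"
    by (metis not_less_eq_eq shift_def)
  then have "u \<in> sites_312 (append_value p (Suc k)) \<longleftrightarrow>
      u \<in> {1..Suc k} \<and> (\<forall>a b. subseq [a, b] p \<longrightarrow> \<not> (b < u \<and> u \<le> a))"
    by (simp add: mem_sites_312_append_value[OF p])
  also have "\<dots> \<longleftrightarrow> u \<in> insert (Suc k) (sites_312 p)"
    using ab length_of_permutation[OF p] unfolding sites_312_def
    by (cases "u = Suc k") (simp, metis not_less_eq_eq, simp add: le_Suc_eq)
  finally show "u \<in> sites_312 (append_value p (Suc k)) \<longleftrightarrow> u \<in> insert (Suc k) (sites_312 p)" .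
qed

text \<open>The new inversions remove all values above \<open>v\<close>, and for
  \<open>u \<le> v\<close> raising the entries does not affect the comparisons with
  \<open>u\<close>.\<close>

lemma sites_312_append_value:
  assumes p: "p \<in> permutations_of_set {1..k}" and v: "v \<in> sites_312 p"
  shows "sites_312 (append_value p v) = {u \<in> sites_312 p. u \<le> v}"
proof (rule set_eqI)
  fix u
  have vk: "v \<in> {1..k}" using v length_of_permutation[OF p] by (simp add: sites_312_def)
  have "shift v b < u \<and> u \<le> shift v a \<longleftrightarrow> b < u \<and> u \<le> a" if "u \<le> v" for a b
    using that by (auto simp: shift_def)
  then show "u \<in> sites_312 (append_value p v) \<longleftrightarrow> u \<in> {u \<in> sites_312 p. u \<le> v}"
    using vk length_of_permutation[OF p] mem_sites_312_append_value[OF p, of v u]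
    by (cases "u \<le> v") (simp_all add: sites_312_def)
qed

lemma finite_sites: "finite (sites_321 p)" "finite (sites_312 p)"
  by (simp_all add: sites_321_def sites_312_def)

section \<open>Both patterns obey the succession rule\<close>

interpretation av321: catalan_pattern "[3, 2, 1]" sites_321
proof
  fix p :: "nat list" and k v :: nat
  show "sites_321 p \<subseteq> {1..length p}" by (auto simp: sites_321_def)
  show "[] \<in> Av 0 [3, 2, 1]" by (simp add: Av_321 del: One_nat_def)
  assume p: "p \<in> permutations_of_set {1..k}"
  have l: "length p = k" by (rule length_of_permutation[OF p])
  show "card (sites_321 (append_value p (Suc k))) = Suc (card (sites_321 p))"
    using l by (simp add: sites_321_append_top[OF p] finite_sites) (simp add: sites_321_def)
  \<comment> \<open>A larger \<open>u\<close> leaves fewer sites: the count is the rank of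
    \<open>u\<close> from above.\<close>
  have "card (sites_321 (append_value p u)) = card {w \<in> sites_321 p. u \<le> w}"
    if "u \<in> sites_321 p" for u
    by (simp add: sites_321_append_value[OF p that] card_image)
  then show "bij_betw (\<lambda>v. card (sites_321 (append_value p v))) (sites_321 p)
      {1..card (sites_321 p)}"
    using bij_betw_dual_rank[OF finite_sites(1)] by (simp cong: bij_betw_cong)
  assume v: "v \<in> {1..Suc k}"
  \<comment> \<open>No entry of \<open>p\<close> reaches \<open>Suc k\<close>, so the top value
    never completes the pattern.\<close>
  have "b \<le> k" if "subseq [a, b] p" for a b
    using subseq_permutation_range(2)[OF p that] by simp
  then have "\<not> (v \<le> b \<and> b < a)" if "v = Suc k" "subseq [a, b] p" for a b
    using that by fastforce
  moreover have "v < shift v b \<and> shift v b < shift v a \<longleftrightarrow> v \<le> b \<and> b < a" for a b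
    by (auto simp: shift_def)
  ultimately have "(\<forall>a b. subseq [a, b] p \<longrightarrow> \<not> (v < shift v b \<and> shift v b < shift v a)) \<longleftrightarrow>
      v \<in> insert (Suc k) (sites_321 p)"
    using v l by (cases "v = Suc k") (simp_all add: sites_321_def le_Suc_eq)
  then show "append_value p v \<in> Av (Suc k) [3, 2, 1] \<longleftrightarrow>
      p \<in> Av k [3, 2, 1] \<and> v \<in> insert (Suc k) (sites_321 p)"
    unfolding Av_321 all_subseq_append_value3 shift_less_iff
    using append_value_in_permutations[OF p v] p by simp
qed

interpretation av312: catalan_pattern "[3, 1, 2]" sites_312
proof
  fix p :: "nat list" and k v :: nat
  show "sites_312 p \<subseteq> {1..length p}" by (auto simp: sites_312_def)
  show "[] \<in> Av 0 [3, 1, 2]" by (simp add: Av_312 del: One_nat_def)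
  assume p: "p \<in> permutations_of_set {1..k}"
  have l: "length p = k" by (rule length_of_permutation[OF p])
  show "card (sites_312 (append_value p (Suc k))) = Suc (card (sites_312 p))"
    using l by (simp add: sites_312_append_top[OF p] finite_sites) (simp add: sites_312_def)
  \<comment> \<open>Here the count is the rank of \<open>v\<close> from below.\<close>
  show "bij_betw (\<lambda>v. card (sites_312 (append_value p v))) (sites_312 p)
      {1..card (sites_312 p)}"
    using bij_betw_rank[OF finite_sites(2)] sites_312_append_value[OF p]
    by (simp cong: bij_betw_cong)
  assume v: "v \<in> {1..Suc k}"
  have "a \<le> k" if "subseq [a, b] p" for a b
    using subseq_permutation_range(1)[OF p that] by simp
  then have "\<not> (b < v \<and> v \<le> a)" if "v = Suc k" "subseq [a, b] p" for a b
    using that by fastforce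
  moreover have "shift v b < v \<and> v < shift v a \<longleftrightarrow> b < v \<and> v \<le> a" for a b
    by (auto simp: shift_def)
  ultimately have "(\<forall>a b. subseq [a, b] p \<longrightarrow> \<not> (shift v b < v \<and> v < shift v a)) \<longleftrightarrow>
      v \<in> insert (Suc k) (sites_312 p)"
    using v l by (cases "v = Suc k") (simp_all add: sites_312_def le_Suc_eq)
  then show "append_value p v \<in> Av (Suc k) [3, 1, 2] \<longleftrightarrow>
      p \<in> Av k [3, 1, 2] \<and> v \<in> insert (Suc k) (sites_312 p)"
    unfolding Av_312 all_subseq_append_value3 shift_less_iff
    using append_value_in_permutations[OF p v] p by simp
qed

theorem theorem4p16:
  fixes N :: nat
  assumes "N \<ge> 1"
  shows "\<exists>\<Phi>.
    bij_betw \<Phi> (prefixes_of N (Av N [3,2,1])) (prefixes_of N (Av N [3,1,2])) \<and>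
    (\<forall>p \<in> prefixes_of N (Av N [3,2,1]). \<forall>q \<in> prefixes_of N (Av N [3,2,1]).
       is_prefix_flattening_of p q \<longleftrightarrow> is_prefix_flattening_of (\<Phi> p) (\<Phi> q)) \<and>
    (\<forall>p \<in> prefixes_of N (Av N [3,2,1]).
       strike_probability N (Av N [3,1,2]) (\<Phi> p) = strike_probability N (Av N [3,2,1]) p)"
  by (rule prefix_trees_isomorphic[OF av321.catalan_pattern_axioms av312.catalan_pattern_axioms])

end
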